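(* Let $\alpha^{+},\lambda^{+},\alpha^{-},\lambda^{-}\in(0,\infty)$, $\beta^{+},\beta^{-}\in[0,1)$ and $X\sim \mathrm{TSD}(\alpha^{+},\beta^{+},\lambda^{+};\alpha^{-},\beta^{-},\lambda^{-})$. For $h\in\mathcal{H}_4$, let $$f_{h}(x):=-\int_{0}^{\infty}e^{-t}\int_{\mathbb{R}}h'(xe^{-t}+y)\,F_{X_{(t)}}(dy)\,dt,\qquad x\in\mathbb{R}.$$ Then the derivatives of $f_h$ up to order three satisfy $$\|f_{h}\|\leq\|h^{(1)}\|,\quad \|f_{h}'\|\leq\tfrac{1}{2}\|h^{(2)}\|,\quad \|f_{h}''\|\leq\tfrac{1}{3}\|h^{(3)}\|,\quad \|f_{h}'''\|\leq\tfrac{1}{4}\|h^{(4)}\|,$$ and for any $x,y\in\mathbb{R}$, $$\left|f_{h}''(x)-f_{h}''(y)\right|\leq\frac{\|h^{(4)}\|}{4}\,|x-y|.$$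
   Context: For $\alpha^{+},\lambda^{+},\alpha^{-},\lambda^{-}\in(0,\infty)$ and $\beta^{+},\beta^{-}\in[0,1)$, a random variable $X$ has the two-sided tempered stable distribution $\mathrm{TSD}(\alpha^{+},\beta^{+},\lambda^{+};\alpha^{-},\beta^{-},\lambda^{-})$ if its characteristic function is $\phi(z)=\exp\left(\int_{\mathbb{R}}(e^{izu}-1)\,\nu(du)\right)$, $z\in\mathbb{R}$, with Lévy measure $$\nu(du)=\left(\frac{\alpha^{+}}{u^{1+\beta^{+}}}e^{-\lambda^{+}u}\mathbf{1}_{(0,\infty)}(u)+\frac{\alpha^{-}}{|u|^{1+\beta^{-}}}e^{-\lambda^{-}|u|}\mathbf{1}_{(-\infty,0)}(u)\right)du.$$ For each $t\ge 0$, the function $\phi_t(z):=\phi(z)/\phi(e^{-t}z)$ is a characteristic function (self-decomposability of $X$); $X_{(t)}$ denotes a random variable with characteristic function $\phi_t$ and $F_{X_{(t)}}$ its distribution. $\mathcal{H}_4$ is the set of four times differentiable functions $h:\mathbb{R}\to\mathbb{R}$ with $\|h^{(k)}\|\le 1$ for $k=0,1,\ldots,4$, where $h^{(0)}=h$ and $\|f\|=\sup_{x\in\mathbb{R}}|f(x)|$. *)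

theory Defs
  imports "HOL-Probability.Probability"
begin

definition tsd_levy_density ::
  "real \<Rightarrow> real \<Rightarrow> real \<Rightarrow> real \<Rightarrow> real \<Rightarrow> real \<Rightarrow> real \<Rightarrow> real" where
  "tsd_levy_density ap bp lp am bm lm u =
     ap / (u powr (1 + bp)) * exp (- lp * u) * indicator {0<..} u
   + am / (\<bar>u\<bar> powr (1 + bm)) * exp (- lm * \<bar>u\<bar>) * indicator {..<0} u"

definition tsd_levy_measure ::
  "real \<Rightarrow> real \<Rightarrow> real \<Rightarrow> real \<Rightarrow> real \<Rightarrow> real \<Rightarrow> real measure" where
  "tsd_levy_measure ap bp lp am bm lm =
     density lborel (\<lambda>u. ennreal (tsd_levy_density ap bp lp am bm lm u))"

definition tsd_char ::
  "real \<Rightarrow> real \<Rightarrow> real \<Rightarrow> real \<Rightarrow> real \<Rightarrow> real \<Rightarrow> real \<Rightarrow> complex" where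
  "tsd_char ap bp lp am bm lm z =
     exp (CLINT u | tsd_levy_measure ap bp lp am bm lm. iexp (z * u) - 1)"

definition has_TSD ::
  "'a measure \<Rightarrow> ('a \<Rightarrow> real) \<Rightarrow> real \<Rightarrow> real \<Rightarrow> real \<Rightarrow> real \<Rightarrow> real \<Rightarrow> real \<Rightarrow> bool" where
  "has_TSD M X ap bp lp am bm lm \<longleftrightarrow>
     prob_space M \<and> X \<in> borel_measurable M \<and>
     (\<forall>z. char (distr M borel X) z = tsd_char ap bp lp am bm lm z)"

definition times_differentiable :: "nat \<Rightarrow> (real \<Rightarrow> real) \<Rightarrow> bool" where
  "times_differentiable n f \<longleftrightarrow> (\<forall>k<n. \<forall>x. (deriv ^^ k) f differentiable (at x))"

text \<open>Extended-real valued, so that an upper bound on the norm entails boundedness.\<close>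

definition sup_norm :: "(real \<Rightarrow> real) \<Rightarrow> ereal" where
  "sup_norm f = (SUP x. ereal \<bar>f x\<bar>)"

definition H4 :: "(real \<Rightarrow> real) set" where
  "H4 = {h. times_differentiable 4 h \<and> (\<forall>k\<le>4. sup_norm ((deriv ^^ k) h) \<le> 1)}"

text \<open>The measure \<open>F t\<close> plays the role of the distribution of \<open>X\<^bsub>(t)\<^esub>\<close>.\<close>

definition stein_solution ::
  "(real \<Rightarrow> real measure) \<Rightarrow> (real \<Rightarrow> real) \<Rightarrow> real \<Rightarrow> real" where
  "stein_solution F h x =
     - (LBINT t:{0..}. exp (- t) * (LINT y | F t. deriv h (x * exp (- t) + y)))"

end

theory Submission
  imports Defs
begin

text \<open>
  Let \<open>T k g x\<close> be the integral over \<open>t \<ge> 0\<close> of \<open>exp (- k t)\<close> times the mean of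
  \<open>g (x exp (- t) + Y)\<close> for \<open>Y\<close> distributed as \<open>X\<^bsub>(t)\<^esub>\<close>, so that \<open>f = - T 1 h'\<close>.
  Each derivative in \<open>x\<close> produces a factor \<open>exp (- t)\<close>, hence \<open>(T k g)' = T (k + 1) g'\<close> by
  dominated convergence, and \<open>T k g\<close> is bounded by the supremum of \<open>\<bar>g\<bar>\<close> divided by \<open>k\<close>.
  Measurability of the integrand in \<open>t\<close> comes from Levy's continuity theorem:
  \<open>\<phi>(z) / \<phi>(exp (- t) z)\<close> is continuous in \<open>t\<close>, so the law of \<open>X\<^bsub>(t)\<^esub>\<close> is weakly
  continuous. As the fourth derivative of \<open>h\<close> need not be continuous, measurability of its
  averages is obtained as that of a limit of difference quotients.
\<close>

section \<open>Differentiation under the integral and bounds for integrals\<close>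

text \<open>The mean value inequality bounds the difference quotients by \<open>D\<close>, so
  dominated convergence applies along every sequence tending to \<open>x\<close>.\<close>

lemma has_real_derivative_integral_dominated:
  fixes g g' :: "real \<Rightarrow> 'a \<Rightarrow> real"
  assumes int: "\<And>x. integrable M (g x)"
    and der: "\<And>x w. w \<in> space M \<Longrightarrow> ((\<lambda>x. g x w) has_real_derivative g' x w) (at x)"
    and bound: "\<And>x w. w \<in> space M \<Longrightarrow> \<bar>g' x w\<bar> \<le> D w"
    and D: "integrable M D"
  shows "((\<lambda>x. \<integral>w. g x w \<partial>M) has_real_derivative (\<integral>w. g' x w \<partial>M)) (at x)"
  unfolding has_field_derivative_iff tendsto_at_iff_sequentially
proof (intro allI impI)
  fix s :: "nat \<Rightarrow> real"
  assume s: "\<forall>i. s i \<in> UNIV - {x}" and lim: "s \<longlonglongrightarrow> x"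
  have q: "(\<lambda>n. (g (s n) w - g x w) / (s n - x)) \<longlonglongrightarrow> g' x w" if "w \<in> space M" for w
    using der[OF that, of x] s lim
    unfolding has_field_derivative_iff tendsto_at_iff_sequentially comp_def by blast
  have b: "\<bar>(g (s n) w - g x w) / (s n - x)\<bar> \<le> D w" if "w \<in> space M" for w n
  proof -
    have "norm (g (s n) w - g x w) \<le> D w * norm (s n - x)"
      by (rule field_differentiable_bound[where S = UNIV and f' = "\<lambda>x. g' x w"])
        (use der bound that in auto)
    moreover have "s n \<noteq> x" using s by auto
    ultimately show ?thesis by (simp add: divide_simps)
  qed
  have mq: "(\<lambda>w. (g (s n) w - g x w) / (s n - x)) \<in> borel_measurable M" for n
    using int by (intro borel_measurable_divide borel_measurable_diff) auto
  have "(\<lambda>n. \<integral>w. (g (s n) w - g x w) / (s n - x) \<partial>M) \<longlonglongrightarrow> (\<integral>w. g' x w \<partial>M)"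
  proof (rule integral_dominated_convergence[where w = D])
    \<comment> \<open>A pointwise limit of measurable difference quotients is measurable; this
      covers averages of a discontinuous fourth derivative.\<close>
    show "g' x \<in> borel_measurable M"
      by (rule borel_measurable_LIMSEQ_real[OF q mq])
  qed (use q b mq D in auto)
  moreover have "(\<integral>w. (g (s n) w - g x w) / (s n - x) \<partial>M)
      = ((\<integral>w. g (s n) w \<partial>M) - (\<integral>w. g x w \<partial>M)) / (s n - x)" for n
    using int by (simp add: Bochner_Integration.integral_diff)
  ultimately show "((\<lambda>y. ((\<integral>w. g y w \<partial>M) - (\<integral>w. g x w \<partial>M)) / (y - x)) \<circ> s)
      \<longlonglongrightarrow> (\<integral>w. g' x w \<partial>M)"
    by (simp only: comp_def)
qed

text \<open>Source of the constants 1, 1/2, 1/3 and 1/4 in the final bounds, taken at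
  \<open>a\<close> = 1, 2, 3, 4.\<close>

lemma has_bochner_integral_exp_Ici:
  assumes "a > (0::real)"
  shows "has_bochner_integral lborel (\<lambda>t. indicator {0..} t * exp (- a * t)) (1 / a)"
proof (rule has_bochner_integral_nn_integral)
  have "((\<lambda>t. exp (- a * t)) has_integral 1 / a) {0..}"
    using has_integral_exp_minus_to_infinity[OF assms, of 0] by simp
  from nn_integral_has_integral_lebesgue[OF _ this]
  show "(\<integral>\<^sup>+ t. ennreal (indicator {0..} t * exp (- a * t)) \<partial>lborel) = ennreal (1 / a)"
    by simp
qed (use assms in auto)

lemma abs_integral_le_integral:
  fixes f g :: "'a \<Rightarrow> real"
  assumes "integrable M g" "\<And>x. \<bar>f x\<bar> \<le> g x"
  shows "\<bar>\<integral>x. f x \<partial>M\<bar> \<le> (\<integral>x. g x \<partial>M)"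
proof (cases "integrable M f")
  case True
  have "\<bar>\<integral>x. f x \<partial>M\<bar> \<le> (\<integral>x. \<bar>f x\<bar> \<partial>M)" by (rule integral_abs_bound)
  also have "\<dots> \<le> (\<integral>x. g x \<partial>M)"
    using True assms by (intro integral_mono) auto
  finally show ?thesis .
next
  case False
  \<comment> \<open>The integral of a non-integrable function is 0 by convention, so only
    nonnegativity of the right-hand side is at stake.\<close>
  have "0 \<le> g x" for x using assms(2)[of x] by simp
  then show ?thesis using False by (simp add: not_integrable_integral_eq)
qed

lemma abs_integral_le_of_bounded:
  fixes g :: "'a \<Rightarrow> real"
  assumes "prob_space M" "\<And>y. \<bar>g y\<bar> \<le> c"
  shows "\<bar>\<integral>y. g y \<partial>M\<bar> \<le> c"
proof -
  interpret prob_space M by fact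
  have "\<bar>\<integral>y. g y \<partial>M\<bar> \<le> (\<integral>y. c \<partial>M)"
    by (rule abs_integral_le_integral) (use assms(2) in auto)
  then show ?thesis by (simp add: prob_space)
qed

section \<open>Exponentially weighted averages over a weakly continuous family of laws\<close>

text \<open>The operator \<open>T k g\<close> of the overview; a free weight \<open>k\<close> keeps
  the family closed under differentiation in \<open>x\<close>.\<close>

definition exp_average :: "(real \<Rightarrow> real measure) \<Rightarrow> real \<Rightarrow> (real \<Rightarrow> real) \<Rightarrow> real \<Rightarrow> real" where
  "exp_average F k g x = (LBINT t:{0..}. exp (- k * t) * (LINT y | F t. g (x * exp (- t) + y)))"

text \<open>All that the analysis uses about the laws of X_(t). Only times \<open>t \<ge> 0\<close>
  are constrained, since \<open>F t\<close> is arbitrary for negative \<open>t\<close>.\<close>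

locale weakly_continuous_distributions =
  fixes F :: "real \<Rightarrow> real measure"
  assumes real_distribution: "t \<ge> 0 \<Longrightarrow> real_distribution (F t)"
    and weak_conv: "(\<And>n. s n \<ge> 0) \<Longrightarrow> t \<ge> 0 \<Longrightarrow> s \<longlonglongrightarrow> t \<Longrightarrow> weak_conv_m (\<lambda>n. F (s n)) (F t)"
begin

lemma prob_space: "t \<ge> 0 \<Longrightarrow> prob_space (F t)"
  using real_distribution real_distribution.axioms(1) by blast

text \<open>Both the law and the integrand move with \<open>t\<close>. With the shift frozen at its
  limit \<open>a\<close>, weak convergence handles the law; the Lipschitz bound on \<open>g\<close>
  handles the shift.\<close>

lemma continuous_on_expectation:
  assumes der: "\<And>x. (g has_real_derivative g' x) (at x)"
    and b: "\<And>x. \<bar>g x\<bar> \<le> c" and b': "\<And>x. \<bar>g' x\<bar> \<le> c'"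
  shows "continuous_on {0..} (\<lambda>t. LINT y | F t. g (x * exp (- t) + y))"
proof (rule continuous_on_sequentiallyI)
  fix s t assume s: "\<forall>n. s n \<in> {0::real..}" and t: "t \<in> {0..}" and lim: "s \<longlonglongrightarrow> t"
  have cont: "continuous_on UNIV g"
    by (rule DERIV_continuous_on) (use der in auto)
  have lip: "\<bar>g u - g v\<bar> \<le> c' * \<bar>u - v\<bar>" for u v
    using field_differentiable_bound[of UNIV g g' c' u v] der b' by auto
  have int: "integrable (F r) (\<lambda>y. g (a + y))" if "r \<ge> 0" for r a
  proof -
    interpret real_distribution "F r" using that by (rule real_distribution)
    have [measurable]: "g \<in> borel_measurable borel"
      using cont by (rule borel_measurable_continuous_onI)
    show ?thesis
      by (rule integrable_const_bound[where B = c]) (use b in auto)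
  qed
  define a where "a = x * exp (- t)"
  have main: "(\<lambda>n. LINT y | F (s n). g (a + y)) \<longlonglongrightarrow> (LINT y | F t. g (a + y))"
  proof (rule weak_conv_imp_integral_bdd_continuous_conv[where B = c])
    show "isCont (\<lambda>y. g (a + y)) y" for y
      by (rule isCont_o2[where f = "(+) a" and g = g]) (auto intro: DERIV_isCont[OF der])
  qed (use s t lim b in \<open>auto intro: real_distribution weak_conv\<close>)
  \<comment> \<open>The Lipschitz estimate holds pointwise in \<open>y\<close>, so it survives
    averaging against any probability law \<open>F (s n)\<close>.\<close>
  have "(\<lambda>n. (LINT y | F (s n). g (x * exp (- s n) + y)) - (LINT y | F (s n). g (a + y))) \<longlonglongrightarrow> 0"
  proof (rule Lim_null_comparison)
    show "\<forall>\<^sub>F n in sequentially. norm ((LINT y | F (s n). g (x * exp (- s n) + y))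
        - (LINT y | F (s n). g (a + y))) \<le> c' * \<bar>x * exp (- s n) - a\<bar>"
    proof (rule always_eventually, rule allI)
      fix n
      have "(LINT y | F (s n). g (x * exp (- s n) + y)) - (LINT y | F (s n). g (a + y))
          = (LINT y | F (s n). g (x * exp (- s n) + y) - g (a + y))"
        using s int by simp
      moreover have "\<bar>LINT y | F (s n). g (x * exp (- s n) + y) - g (a + y)\<bar>
          \<le> c' * \<bar>x * exp (- s n) - a\<bar>"
      proof (rule abs_integral_le_of_bounded)
        show "\<bar>g (x * exp (- s n) + y) - g (a + y)\<bar> \<le> c' * \<bar>x * exp (- s n) - a\<bar>" for y
          using lip[of "x * exp (- s n) + y" "a + y"] by simp
      qed (use s prob_space in auto)
      ultimately show "norm ((LINT y | F (s n). g (x * exp (- s n) + y))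
        - (LINT y | F (s n). g (a + y))) \<le> c' * \<bar>x * exp (- s n) - a\<bar>" by simp
    qed
    have "(\<lambda>n. c' * \<bar>x * exp (- s n) - a\<bar>) \<longlonglongrightarrow> c' * \<bar>x * exp (- t) - a\<bar>"
      by (intro tendsto_intros lim)
    then show "(\<lambda>n. c' * \<bar>x * exp (- s n) - a\<bar>) \<longlonglongrightarrow> 0" by (simp add: a_def)
  qed
  from tendsto_add[OF this main]
  show "(\<lambda>n. LINT y | F (s n). g (x * exp (- s n) + y)) \<longlonglongrightarrow> (LINT y | F t. g (x * exp (- t) + y))"
    by (simp add: a_def)
qed

text \<open>Averaging against a probability law keeps the bound \<open>c\<close>, and the weight has
  total mass \<open>1 / k\<close>.\<close>

lemma abs_exp_average_le:
  assumes "k > 0" and b: "\<And>x. \<bar>g x\<bar> \<le> c"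
  shows "\<bar>exp_average F k g x\<bar> \<le> c / k"
proof -
  note ex = has_bochner_integral_exp_Ici[OF \<open>k > 0\<close>]
  have "\<bar>exp_average F k g x\<bar> \<le> (\<integral>t. c * (indicator {0..} t * exp (- k * t)) \<partial>lborel)"
    unfolding exp_average_def set_lebesgue_integral_def
  proof (rule abs_integral_le_integral)
    show "integrable lborel (\<lambda>t. c * (indicator {0..} t * exp (- k * t)))"
      using ex by (intro integrable_mult_right) (auto simp: has_bochner_integral_iff)
    show "\<bar>indicat_real {0..} t *\<^sub>R
        (exp (- k * t) * (LINT y | F t. g (x * exp (- t) + y)))\<bar> \<le> c * (indicator {0..} t * exp (- k * t))" for t
      using b
      by (auto simp: abs_mult indicator_def mult.commute intro!: mult_left_mono abs_integral_le_of_bounded prob_space)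
  qed
  also have "\<dots> = c / k"
    using ex by (simp add: has_bochner_integral_iff)
  finally show ?thesis .
qed

text \<open>Differentiation under the integral is applied twice, first in \<open>y\<close> for fixed
  \<open>t\<close> and then in \<open>t\<close>; the chain rule factor \<open>exp (- t)\<close>
  raises the weight from \<open>k\<close> to \<open>k + 1\<close>.\<close>

lemma has_real_derivative_exp_average:
  assumes "k > 0" and der: "\<And>x. (g has_real_derivative g' x) (at x)"
    and b: "\<And>x. \<bar>g x\<bar> \<le> c" and b': "\<And>x. \<bar>g' x\<bar> \<le> c'"
  shows "(exp_average F k g has_real_derivative exp_average F (k + 1) g' x) (at x)"
proof -
  have inner: "((\<lambda>x. LINT y | F t. g (x * exp (- t) + y)) has_real_derivative
      (LINT y | F t. g' (x * exp (- t) + y) * exp (- t))) (at x)" if "t \<ge> 0" for t x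
  proof -
    interpret real_distribution "F t" using that by (rule real_distribution)
    have cont: "continuous_on UNIV g"
      by (rule DERIV_continuous_on) (use der in auto)
    have [measurable]: "g \<in> borel_measurable borel"
      using cont by (rule borel_measurable_continuous_onI)
    show ?thesis
    proof (rule has_real_derivative_integral_dominated[where D = "\<lambda>_. c' * exp (- t)"])
      show "integrable (F t) (\<lambda>y. g (x * exp (- t) + y))" for x
        by (rule integrable_const_bound[where B = c]) (use b in auto)
      show "((\<lambda>x. g (x * exp (- t) + y)) has_real_derivative g' (x * exp (- t) + y) * exp (- t)) (at x)" for x y
        by (rule DERIV_chain2[OF der]) (auto intro!: derivative_eq_intros)
    qed (use b' in \<open>auto simp: abs_mult\<close>)
  qed
  have "((\<lambda>x. \<integral>t. indicator {0..} t *\<^sub>R (exp (- k * t) * (LINT y | F t. g (x * exp (- t) + y))) \<partial>lborel)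
    has_real_derivative
     (\<integral>t. indicator {0..} t *\<^sub>R (exp (- (k + 1) * t) * (LINT y | F t. g' (x * exp (- t) + y))) \<partial>lborel)) (at x)"
  proof (rule has_real_derivative_integral_dominated[where D = "\<lambda>t. c' * (indicator {0..} t * exp (- (k + 1) * t))"])
    fix x
    show "integrable lborel (\<lambda>t. indicator {0..} t *\<^sub>R (exp (- k * t) * (LINT y | F t. g (x * exp (- t) + y))))"
    proof (rule Bochner_Integration.integrable_bound)
      show "integrable lborel (\<lambda>t. c * (indicator {0..} t * exp (- k * t)))"
        using has_bochner_integral_exp_Ici[OF \<open>k > 0\<close>]
        by (intro integrable_mult_right) (auto simp: has_bochner_integral_iff)
      \<comment> \<open>Weak continuity enters here: the average of \<open>g\<close> is continuous
        in \<open>t\<close>, hence measurable on the half-line.\<close>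
      show "(\<lambda>t. indicator {0..} t *\<^sub>R (exp (- k * t) * (LINT y | F t. g (x * exp (- t) + y)))) \<in> borel_measurable lborel"
        using continuous_on_expectation[OF der b b']
        by (simp del: real_scaleR_def) (intro borel_measurable_continuous_on_indicator continuous_intros; simp)
      show "AE t in lborel. norm (indicat_real {0..} t *\<^sub>R
        (exp (- k * t) * (LINT y | F t. g (x * exp (- t) + y)))) \<le> norm (c * (indicator {0..} t * exp (- k * t)))"
        using b order_trans[OF abs_ge_zero b] by (auto simp: abs_mult indicator_def mult.commute
            intro!: mult_left_mono abs_integral_le_of_bounded prob_space)
    qed
  next
    fix x t :: real
    show "((\<lambda>x. indicator {0..} t *\<^sub>R (exp (- k * t) * (LINT y | F t. g (x * exp (- t) + y)))) has_real_derivative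
      indicator {0..} t *\<^sub>R (exp (- (k + 1) * t) * (LINT y | F t. g' (x * exp (- t) + y)))) (at x)"
    proof (cases "t \<ge> 0")
      case True
      have "exp (- k * t) * (LINT y | F t. g' (x * exp (- t) + y) * exp (- t))
        = exp (- (k + 1) * t) * (LINT y | F t. g' (x * exp (- t) + y))"
        by (simp add: algebra_simps exp_diff exp_minus divide_simps)
      with DERIV_cmult[OF inner[OF True], of "exp (- k * t)" x] True show ?thesis
        by (simp only: indicator_simps atLeast_iff scaleR_one)
    qed auto
  next
    fix x t :: real
    show "\<bar>indicator {0..} t *\<^sub>R (exp (- (k + 1) * t) * (LINT y | F t. g' (x * exp (- t) + y)))\<bar>
      \<le> c' * (indicator {0..} t * exp (- (k + 1) * t))"
      using b' by (auto simp: abs_mult indicator_def mult.commute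
            intro!: mult_left_mono abs_integral_le_of_bounded prob_space)
  next
    show "integrable lborel (\<lambda>t. c' * (indicator {0..} t * exp (- (k + 1) * t)))"
      using has_bochner_integral_exp_Ici[of "k + 1"] \<open>k > 0\<close>
      by (intro integrable_mult_right) (auto simp: has_bochner_integral_iff)
  qed
  then show ?thesis
    unfolding exp_average_def set_lebesgue_integral_def .
qed

end

section \<open>Weak continuity from characteristic functions\<close>

text \<open>The numerator is constant in \<open>t\<close> and the denominator is continuous and
  nonzero, so the characteristic functions converge pointwise and Levy's theorem applies.\<close>

lemma weakly_continuous_distributions_char_quotient:
  assumes \<mu>: "real_distribution \<mu>" and nz: "\<And>z. char \<mu> z \<noteq> 0"
    and F: "\<And>t. t \<ge> 0 \<Longrightarrow> real_distribution (F t)"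
    and char: "\<And>t z. t \<ge> 0 \<Longrightarrow> char (F t) z = char \<mu> z / char \<mu> (exp (- t) * z)"
  shows "weakly_continuous_distributions F"
proof (rule weakly_continuous_distributions.intro)
  fix s :: "nat \<Rightarrow> real" and t :: real
  assume s: "\<And>n. s n \<ge> 0" and t: "t \<ge> 0" and lim: "s \<longlonglongrightarrow> t"
  show "weak_conv_m (\<lambda>n. F (s n)) (F t)"
  proof (rule levy_continuity)
    fix z
    have "(\<lambda>n. char \<mu> (exp (- s n) * z)) \<longlonglongrightarrow> char \<mu> (exp (- t) * z)"
      by (rule isCont_tendsto_compose[OF real_distribution.isCont_char[OF \<mu>]]) (intro tendsto_intros lim)
    then have "(\<lambda>n. char \<mu> z / char \<mu> (exp (- s n) * z)) \<longlonglongrightarrow> char \<mu> z / char \<mu> (exp (- t) * z)"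
      by (intro tendsto_intros nz)
    then show "(\<lambda>n. char (F (s n)) z) \<longlonglongrightarrow> char (F t) z"
      using s t by (simp add: char)
  qed (use s t F in auto)
qed (fact F)

section \<open>Supremum norms and the bounds for the Stein solution\<close>

lemma sup_norm_le_realI:
  assumes "\<And>x. \<bar>f x\<bar> \<le> c"
  shows "sup_norm f \<le> ereal c"
  unfolding sup_norm_def using assms by (intro SUP_least) auto

lemma sup_norm_realE:
  assumes "sup_norm f \<le> ereal b"
  obtains c where "sup_norm f = ereal c" "\<And>x. \<bar>f x\<bar> \<le> c"
proof -
  have le: "ereal \<bar>f x\<bar> \<le> sup_norm f" for x
    unfolding sup_norm_def by (rule SUP_upper) simp
  \<comment> \<open>The value at 0 excludes minus infinity, the assumed bound plus infinity.\<close>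
  from le[of 0] assms have "\<bar>sup_norm f\<bar> \<noteq> \<infinity>" by auto
  then obtain c where "sup_norm f = ereal c" by auto
  with le that show ?thesis by auto
qed

theorem theorem3p10:
  fixes ap bp lp am bm lm :: real
    and M :: "'a measure" and X :: "'a \<Rightarrow> real"
    and N :: "real \<Rightarrow> 'b measure" and Xt :: "real \<Rightarrow> 'b \<Rightarrow> real"
    and h f :: "real \<Rightarrow> real"
  assumes "ap > 0" "lp > 0" "am > 0" "lm > 0"
    and "0 \<le> bp" "bp < 1" "0 \<le> bm" "bm < 1"
    and "has_TSD M X ap bp lp am bm lm"
    and "\<And>t. t \<ge> 0 \<Longrightarrow> prob_space (N t)"
    and "\<And>t. t \<ge> 0 \<Longrightarrow> Xt t \<in> borel_measurable (N t)"
    and "\<And>t z. t \<ge> 0 \<Longrightarrow> char (distr (N t) borel (Xt t)) z =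
           char (distr M borel X) z / char (distr M borel X) (exp (- t) * z)"
    and "h \<in> H4"
  defines "f \<equiv> stein_solution (\<lambda>t. distr (N t) borel (Xt t)) h"
  shows "times_differentiable 3 f \<and>
         sup_norm f \<le> sup_norm (deriv h) \<and>
         sup_norm (deriv f) \<le> ereal (1 / 2) * sup_norm ((deriv ^^ 2) h) \<and>
         sup_norm ((deriv ^^ 2) f) \<le> ereal (1 / 3) * sup_norm ((deriv ^^ 3) h) \<and>
         sup_norm ((deriv ^^ 3) f) \<le> ereal (1 / 4) * sup_norm ((deriv ^^ 4) h) \<and>
         (\<forall>x y. ereal \<bar>(deriv ^^ 2) f x - (deriv ^^ 2) f y\<bar>
                  \<le> sup_norm ((deriv ^^ 4) h) / 4 * ereal \<bar>x - y\<bar>)"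
proof -
  define F where "F = (\<lambda>t. distr (N t) borel (Xt t))"
  \<comment> \<open>The characteristic function is an exponential, so it never vanishes.\<close>
  have tsd: "prob_space M" "X \<in> borel_measurable M" "char (distr M borel X) z \<noteq> 0" for z
    using \<open>has_TSD M X ap bp lp am bm lm\<close> by (auto simp: has_TSD_def tsd_char_def)
  interpret weakly_continuous_distributions F
  proof (rule weakly_continuous_distributions_char_quotient)
    show "real_distribution (distr M borel X)"
      using tsd by (intro prob_space.real_distribution_distr)
    show "real_distribution (F t)" if "t \<ge> 0" for t
      unfolding F_def using assms(10,11)[OF that] by (intro prob_space.real_distribution_distr)
    show "char (F t) z = char (distr M borel X) z / char (distr M borel X) (exp (- t) * z)"
      if "t \<ge> 0" for t z
      unfolding F_def using that by (rule assms(12))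
  qed (fact tsd)
  define d where "d k = (deriv ^^ k) h" for k
  \<comment> \<open>The bound 1 from \<open>H4\<close> serves only to make the norms finite; the
    exact value \<open>c k\<close> is kept for the final estimates.\<close>
  have "\<exists>c. sup_norm (d k) = ereal c \<and> (\<forall>x. \<bar>d k x\<bar> \<le> c)" if "k \<le> 4" for k
  proof -
    have "sup_norm (d k) \<le> ereal 1"
      using \<open>h \<in> H4\<close> that by (simp add: H4_def d_def one_ereal_def)
    then show ?thesis by (rule sup_norm_realE) blast
  qed
  then obtain c where sup: "\<And>k. k \<le> 4 \<Longrightarrow> sup_norm (d k) = ereal (c k)"
    and bd: "\<And>k x. k \<le> 4 \<Longrightarrow> \<bar>d k x\<bar> \<le> c k" by metis
  have der: "(d k has_real_derivative d (Suc k) x) (at x)" if "k < 4" for k x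
    using \<open>h \<in> H4\<close> that
    by (auto simp: H4_def d_def times_differentiable_def DERIV_deriv_iff_real_differentiable)
  \<comment> \<open>The candidate for the derivative of order \<open>k\<close> of \<open>f\<close>:
    both the weight and the order of the derivative of \<open>h\<close> start at 1 and grow by one
    each time.\<close>
  define e where "e k x = - exp_average F (real (Suc k)) (d (Suc k)) x" for k x
  have e_der: "(e k has_real_derivative e (Suc k) x) (at x)" if "k < 3" for k x
  proof -
    have "(exp_average F (real (Suc k)) (d (Suc k)) has_real_derivative
        exp_average F (real (Suc k) + 1) (d (Suc (Suc k))) x) (at x)"
      by (rule has_real_derivative_exp_average[OF _ der bd bd]) (use that in auto)
    from DERIV_minus[OF this] show ?thesis by (simp add: e_def[abs_def] add.commute)
  qed
  \<comment> \<open>Here \<open>k = 3\<close> is included, as only boundedness of \<open>d 4\<close>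
    enters.\<close>
  have e_bd: "\<bar>e k x\<bar> \<le> c (Suc k) / real (Suc k)" if "k \<le> 3" for k x
    unfolding e_def abs_minus_cancel by (rule abs_exp_average_le[OF _ bd]) (use that in auto)
  have f0: "f = e 0"
    by (auto simp: f_def e_def F_def stein_solution_def exp_average_def d_def fun_eq_iff)
  have f_eq: "(deriv ^^ k) f = e k" if "k \<le> 3" for k
    using that
  proof (induction k)
    case (Suc k)
    then have "(deriv ^^ Suc k) f = deriv (e k)" by simp
    also have "\<dots> = e (Suc k)"
      using Suc.prems e_der[of k] by (intro ext DERIV_imp_deriv) simp
    finally show ?case .
  qed (simp add: f0)
  have diff: "times_differentiable 3 f"
    unfolding times_differentiable_def using f_eq e_der
    by (auto simp: real_differentiable_def)
  have norm: "sup_norm ((deriv ^^ k) f) \<le> ereal (1 / real (Suc k)) * sup_norm ((deriv ^^ Suc k) h)"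
    if "k \<le> 3" for k
  proof -
    have "sup_norm (e k) \<le> ereal (c (Suc k) / real (Suc k))"
      using e_bd[OF that] by (rule sup_norm_le_realI)
    then show ?thesis
      using that sup[of "Suc k"] by (simp add: f_eq d_def)
  qed
  have lip: "ereal \<bar>(deriv ^^ 2) f x - (deriv ^^ 2) f y\<bar>
      \<le> sup_norm ((deriv ^^ 4) h) / 4 * ereal \<bar>x - y\<bar>" for x y
  proof -
    \<comment> \<open>Mean value inequality with the bound on the third derivative
      \<open>e 3\<close>.\<close>
    have "norm (e 2 x - e 2 y) \<le> c 4 / 4 * norm (x - y)"
      by (rule field_differentiable_bound[where S = UNIV and f' = "e 3"])
        (use e_der[of 2] e_bd[of 3] in auto)
    then show ?thesis
      using sup[of 4] by (simp add: f_eq d_def)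
  qed
  show ?thesis
  proof (intro conjI allI)
    show "sup_norm f \<le> sup_norm (deriv h)"
      using norm[of 0] by (simp add: one_ereal_def[symmetric])
    show "sup_norm (deriv f) \<le> ereal (1 / 2) * sup_norm ((deriv ^^ 2) h)"
      using norm[of 1] by (simp add: numeral_2_eq_2)
    show "sup_norm ((deriv ^^ 2) f) \<le> ereal (1 / 3) * sup_norm ((deriv ^^ 3) h)"
      using norm[of 2] by simp
    show "sup_norm ((deriv ^^ 3) f) \<le> ereal (1 / 4) * sup_norm ((deriv ^^ 4) h)"
      using norm[of 3] by simp
  qed (fact diff lip)+
qed

end
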